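(* Let $X$ be an $n$-dimensional toric Fano manifold, with associated open polytope $\triangle\subset\mathbb{R}^n$, affine function $l$, invariant $\alpha_X$, function space $\tilde{\mathcal{C}}$, relative Ding-Futaki invariant $\mathcal{I}$ and modified Ding functional $\mathcal{D}$ as defined in the context. Then the following three conditions are equivalent. (1) $\alpha_X\leq 1$. (2) $X$ is relative Ding stable, that is, $\mathcal{I}(u)\geq 0$ holds for all $u\in\tilde{\mathcal{C}}$. (3) For every $\varepsilon>0$ there exists a constant $C_\varepsilon>0$ such that \[ \mathcal{D}(u)\geq -\varepsilon\int_{\triangle}u\,dx - C_\varepsilon \] holds for every $u\in\tilde{\mathcal{C}}$.
   Context: Let $X$ be an $n$-dimensional toric Fano manifold, and let $\triangle\subset\mathbb{R}^n$ be the open set whose closure $\overline{\triangle}$ is the reflexive integral Delzant polytope corresponding to $X$ (with its anticanonical polarization); $0\in\mathbb{R}^n$ is the only integral point in $\triangle$. Write $|\triangle|=\int_\triangle dx$ for its Lebesgue volume. Let $(\mathbb{C}^* )^n=(S^1)^n\times\mathbb{R}^n$ be the open dense orbit in $X$, with standard coordinates $z_i$, and let $\xi_i=\log|z_i|^2$ be the coordinates of $\mathbb{R}^n$. Fix an $(S^1)^n$-invariant reference Kähler metric $\omega_0\in 2\pi c_1(X)$. There is a smooth convex function $\phi_0=\phi_0(\xi_1,\dots,\xi_n)$ on $\mathbb{R}^n$ with $\omega_0=\sqrt{-1}\,\partial\overline{\partial}\phi_0$ on $(\mathbb{C}^* )^n$, where $\phi_0$ is normalized (by adding a linear function) so that the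 image of $\nabla\phi_0$ is $\triangle$. Let $u_0(x)=\sup_{\xi\in\mathbb{R}^n}(x\cdot\xi-\phi_0(\xi))$ be the Legendre dual of $\phi_0$; it is a smooth convex function on $\triangle$ (extending continuously to $\overline{\triangle}$). Define \[ \mathcal{C}=\{u\in C^0(\overline{\triangle}) : u \text{ is convex on }\triangle \text{ and } u-u_0\in C^\infty(\overline{\triangle})\}, \qquad \tilde{\mathcal{C}}=\{u\in\mathcal{C} : u\geq u(0)=0\}. \] Let $l$ be the unique affine linear function on $\triangle$ such that $-u(0)+\int_\triangle u\, l\,dx=0$ for every affine linear function $u$. For $u\in\mathcal{C}$, the relative Ding-Futaki invariant is \[ \mathcal{I}(u)=-u(0)+\int_\triangle u\, l\,dx , \] and the modified Ding functional is \[ \mathcal{D}(u)=-\log\int_{\mathbb{R}^n}e^{-(\phi-\inf\phi)}\,d\xi-u(0)+\int_\triangle u\, l\,dx, \] where $\phi(\xi)=\sup_{x\in\triangle}(x\cdot\xi-u(x))$ is the Legendre dual of $u$. The invariant $\alpha_X$ is defined by \[ \alpha_X=\max_{\overline{\triangle}}\,(1-|\triangle|\, l). \] *)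

theory Defs
  imports "HOL-Analysis.Analysis"
begin

section \<open>Smooth functions, Legendre duals\<close>

fun Ck_on :: "nat \<Rightarrow> 'a::euclidean_space set \<Rightarrow> ('a \<Rightarrow> real) \<Rightarrow> bool" where
  "Ck_on 0 S f \<longleftrightarrow> continuous_on S f"
| "Ck_on (Suc k) S f \<longleftrightarrow>
     (\<forall>x\<in>S. f differentiable (at x)) \<and>
     (\<forall>v. Ck_on k S (\<lambda>x. frechet_derivative f (at x) v))"

text \<open>Only meant for open \<open>S\<close>.\<close>

definition smooth_on :: "'a::euclidean_space set \<Rightarrow> ('a \<Rightarrow> real) \<Rightarrow> bool" where
  "smooth_on S f \<longleftrightarrow> (\<forall>k. Ck_on k S f)"

definition second_derivative :: "('a::euclidean_space \<Rightarrow> real) \<Rightarrow> 'a \<Rightarrow> 'a \<Rightarrow> 'a \<Rightarrow> real" where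
  "second_derivative f x v w =
     frechet_derivative (\<lambda>y. frechet_derivative f (at y) v) (at x) w"

text \<open>
  Positivity of the (1,1)-form \<open>\<i> \<partial>\<partial>\<close>-bar \<open>f\<close>: four times the Levi form of \<open>f\<close> at \<open>w\<close> in the
  direction \<open>v\<close> is the Laplacian at 0 of \<open>\<zeta> \<mapsto> f (w + \<zeta> v)\<close>, \<open>\<zeta>\<close> complex.
\<close>

definition strictly_plurisubharmonic :: "(complex ^ 'n \<Rightarrow> real) \<Rightarrow> bool" where
  "strictly_plurisubharmonic f \<longleftrightarrow>
     (\<forall>w v. v \<noteq> 0 \<longrightarrow>
        second_derivative f w v v + second_derivative f w (\<i> *s v) (\<i> *s v) > 0)"

definition legendre_dual :: "'a::euclidean_space set \<Rightarrow> ('a \<Rightarrow> real) \<Rightarrow> 'a \<Rightarrow> real" where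
  "legendre_dual S f y = (SUP x\<in>S. x \<bullet> y - f x)"

definition affine_function :: "('a::euclidean_space \<Rightarrow> real) \<Rightarrow> bool" where
  "affine_function f \<longleftrightarrow> (\<exists>a b. \<forall>x. f x = a \<bullet> x + b)"


section \<open>Toric Fano manifolds\<close>

text \<open>
  A toric Fano manifold \<open>X\<close> is given by its anticanonical polytope \<open>P\<close>, a reflexive integral
  Delzant polytope.  The open polytope of the context is \<open>interior P\<close>, and \<open>P\<close> is its closure.
\<close>

definition integer_lattice :: "(real ^ 'n) set" where
  "integer_lattice = {x. \<forall>i. x $ i \<in> \<int>}"

definition integral_polytope :: "(real ^ 'n) set \<Rightarrow> bool" where
  "integral_polytope P \<longleftrightarrow> polytope P \<and> (\<forall>p. p extreme_point_of P \<longrightarrow> p \<in> integer_lattice)"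

definition dual_polytope :: "(real ^ 'n) set \<Rightarrow> (real ^ 'n) set" where
  "dual_polytope P = {y. \<forall>x\<in>P. x \<bullet> y \<ge> -1}"

definition reflexive :: "(real ^ 'n) set \<Rightarrow> bool" where
  "reflexive P \<longleftrightarrow>
     integral_polytope P \<and> 0 \<in> interior P \<and> integral_polytope (dual_polytope P)"

definition lattice_basis :: "('n \<Rightarrow> real ^ 'n) \<Rightarrow> bool" where
  "lattice_basis v \<longleftrightarrow>
     (\<forall>j. v j \<in> integer_lattice) \<and>
     (\<forall>m\<in>integer_lattice. \<exists>!c :: 'n \<Rightarrow> int. m = (\<Sum>j\<in>UNIV. of_int (c j) *\<^sub>R v j))"

text \<open>
  \<open>v\<close> lists the primitive generators of the edges of \<open>P\<close> at the vertex \<open>p\<close>, and these form a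
  basis of the lattice.
\<close>

definition delzant_frame :: "(real ^ 'n) set \<Rightarrow> real ^ 'n \<Rightarrow> ('n \<Rightarrow> real ^ 'n) \<Rightarrow> bool" where
  "delzant_frame P p v \<longleftrightarrow>
     p extreme_point_of P \<and> lattice_basis v \<and>
     {e. e edge_of P \<and> p \<in> e} = range (\<lambda>j. P \<inter> {p + t *\<^sub>R v j |t. t \<ge> 0})"

definition delzant :: "(real ^ 'n) set \<Rightarrow> bool" where
  "delzant P \<longleftrightarrow> (\<forall>p. p extreme_point_of P \<longrightarrow> (\<exists>v. delzant_frame P p v))"

definition toric_fano_polytope :: "(real ^ 'n) set \<Rightarrow> bool" where
  "toric_fano_polytope P \<longleftrightarrow> reflexive P \<and> delzant P"

text \<open>
  \<open>X\<close> is covered by charts, one for each vertex \<open>p\<close> of \<open>P\<close> with edge generators \<open>v\<close>, identified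
  with the whole of complex \<open>n\<close>-space by the coordinates \<open>w\<^sub>j = z\<^bsup>v\<^sub>j\<^esup>\<close>, which on the open orbit
  satisfy \<open>|w\<^sub>j|\<^sup>2 = exp (v\<^sub>j \<bullet> \<xi>)\<close>.  There the Laurent monomial \<open>z\<^bsup>p\<^esup>\<close>, viewed as a section of the
  anticanonical bundle (the monomial 1 being the invariant section \<open>\<And>\<^sub>i z\<^sub>i \<partial>/\<partial>z\<^sub>i\<close>), is a frame.
  A torus-invariant Hermitian metric on the anticanonical bundle is thus a weight \<open>\<phi>\<close> on the
  open orbit such that in every chart \<open>\<phi>(\<xi>) - p \<bullet> \<xi> = - log |z\<^bsup>p\<^esup>|\<^sup>2\<^sub>h\<close> extends to a smooth function
  \<open>f\<close> of \<open>w\<close>.  Its curvature form, which represents \<open>2 \<pi> c\<^sub>1(X)\<close>, is \<open>\<i> \<partial>\<partial>\<close>-bar \<open>f\<close> in the chart and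
  \<open>\<i> \<partial>\<partial>\<close>-bar \<open>\<phi>\<close> on the open orbit (\<open>p \<bullet> \<xi>\<close> is pluriharmonic); it is a Kaehler metric iff every \<open>f\<close>
  is strictly plurisubharmonic.  The last condition normalises the linear part of \<open>\<phi>\<close>.
\<close>

definition anticanonical_kaehler_potential :: "(real ^ 'n) set \<Rightarrow> (real ^ 'n \<Rightarrow> real) \<Rightarrow> bool" where
  "anticanonical_kaehler_potential P \<phi> \<longleftrightarrow>
     smooth_on UNIV \<phi> \<and> convex_on UNIV \<phi> \<and>
     (\<forall>p v. delzant_frame P p v \<longrightarrow>
        (\<exists>f :: complex ^ 'n \<Rightarrow> real.
           smooth_on UNIV f \<and> strictly_plurisubharmonic f \<and>
           (\<forall>w \<xi>. (\<forall>j. (norm (w $ j))\<^sup>2 = exp (v j \<bullet> \<xi>)) \<longrightarrow> f w = \<phi> \<xi> - p \<bullet> \<xi>))) \<and>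
     {g. \<exists>\<xi>. GDERIV \<phi> \<xi> :> g} = interior P"


section \<open>Ding functionals\<close>

text \<open>
  \<open>\<phi>\<^sub>0\<close> is the potential of the reference metric and \<open>u\<^sub>0 = legendre_dual UNIV \<phi>\<^sub>0\<close>.  Functions in
  the class are only constrained on the closed polytope \<open>P\<close>.  Smoothness of \<open>u - u\<^sub>0\<close> up to the
  boundary means being the restriction of a function smooth near \<open>P\<close>; as \<open>u\<close> is continuous on \<open>P\<close>,
  it suffices to compare on \<open>interior P\<close>, without using boundary values of \<open>u\<^sub>0\<close>.
\<close>

definition potential_class ::
    "(real ^ 'n) set \<Rightarrow> (real ^ 'n \<Rightarrow> real) \<Rightarrow> (real ^ 'n \<Rightarrow> real) set" where
  "potential_class P \<phi>\<^sub>0 =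
     {u. continuous_on P u \<and> convex_on (interior P) u \<and>
         (\<exists>U g. open U \<and> P \<subseteq> U \<and> smooth_on U g \<and>
            (\<forall>x\<in>interior P. u x - legendre_dual UNIV \<phi>\<^sub>0 x = g x))}"

definition normalized_class ::
    "(real ^ 'n) set \<Rightarrow> (real ^ 'n \<Rightarrow> real) \<Rightarrow> (real ^ 'n \<Rightarrow> real) set" where
  "normalized_class P \<phi>\<^sub>0 = {u \<in> potential_class P \<phi>\<^sub>0. u 0 = 0 \<and> (\<forall>x\<in>P. u x \<ge> u 0)}"

definition extremal_affine :: "(real ^ 'n) set \<Rightarrow> real ^ 'n \<Rightarrow> real" where
  "extremal_affine P =
     (THE l. affine_function l \<and>
        (\<forall>u. affine_function u \<longrightarrow> - u 0 + (LINT x:interior P|lborel. u x * l x) = 0))"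

definition relative_ding_futaki :: "(real ^ 'n) set \<Rightarrow> (real ^ 'n \<Rightarrow> real) \<Rightarrow> real" where
  "relative_ding_futaki P u = - u 0 + (LINT x:interior P|lborel. u x * extremal_affine P x)"

definition modified_ding :: "(real ^ 'n) set \<Rightarrow> (real ^ 'n \<Rightarrow> real) \<Rightarrow> real" where
  "modified_ding P u =
     (let \<phi> = legendre_dual (interior P) u in
      - ln (LINT \<xi>|lborel. exp (- (\<phi> \<xi> - (INF \<eta>. \<phi> \<eta>))))
      - u 0 + (LINT x:interior P|lborel. u x * extremal_affine P x))"

definition alpha_invariant :: "(real ^ 'n) set \<Rightarrow> real" where
  "alpha_invariant P = (SUP x\<in>P. 1 - measure lborel (interior P) * extremal_affine P x)"

definition relative_ding_stable :: "(real ^ 'n) set \<Rightarrow> (real ^ 'n \<Rightarrow> real) \<Rightarrow> bool" where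
  "relative_ding_stable P \<phi>\<^sub>0 \<longleftrightarrow> (\<forall>u\<in>normalized_class P \<phi>\<^sub>0. relative_ding_futaki P u \<ge> 0)"

end

theory Submission
  imports Defs "HOL-Real_Asymp.Real_Asymp"
begin

text \<open>
  \<open>\<alpha>\<^sub>X \<le> 1\<close> says that \<open>l \<ge> 0\<close> on the polytope; then stability is clear because normalised functions
  are nonnegative, and for coercivity only \<open>log \<integral> exp (-\<phi>) \<le> \<epsilon> \<integral> u + C\<close> is needed.  By convexity \<open>u\<close> is
  bounded by a multiple \<open>K\<close> of \<open>\<integral> u\<close> on a small ball about 0, hence by \<open>s K\<close> on the ball shrunk by
  \<open>s \<le> 1\<close>, so \<open>\<phi>(\<xi>) \<ge> s (\<rho> |\<xi>| - K)\<close>, and \<open>s\<close> may be taken proportional to \<open>\<epsilon>\<close>.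

  Conversely, if \<open>l < 0\<close> somewhere, then \<open>\<integral> g l < 0\<close> for a function \<open>g(x) = exp (a \<bullet> x) - 1 - a \<bullet> x\<close>, which
  is smooth, convex and minimal at 0.  Along the ray \<open>u + t g\<close> the invariant \<open>\<I>\<close> decreases linearly,
  while the logarithmic term of \<open>\<D>\<close> stays bounded above since \<open>\<phi>(\<xi>) \<le> R |\<xi>|\<close>.  The base point of the ray
  is the Legendre dual \<open>u\<^sub>0\<close> of the reference potential minus a linear function: the charts at the
  vertices show that \<open>\<phi>\<^sub>0\<close> is bounded below by the support function of the polytope up to a constant,
  so \<open>u\<^sub>0\<close> is bounded, and a bounded lower semicontinuous convex function on a polytope is continuous.
\<close>

section \<open>The Legendre dual of the reference potential\<close>

text \<open>This family is closed under directional derivatives: along \<open>v\<close> the factor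
  \<alpha> is multiplied by \<open>a \<bullet> v\<close>, and the linear term turns into the
  constant \<open>b \<bullet> v\<close>. The induction therefore generalises over all three
  coefficients.\<close>

lemma Ck_on_exp_affine:
  fixes a b :: "'a::euclidean_space"
  shows "Ck_on k S (\<lambda>x. \<alpha> * exp (a \<bullet> x) + b \<bullet> x + c)"
proof (induction k arbitrary: \<alpha> b c)
  case 0
  show ?case by (auto intro!: continuous_intros)
next
  case (Suc k)
  have D: "((\<lambda>x. \<alpha> * exp (a \<bullet> x) + b \<bullet> x + c) has_derivative
      (\<lambda>v. \<alpha> * (a \<bullet> v) * exp (a \<bullet> x) + b \<bullet> v)) (at x)" for x
    by (auto intro!: derivative_eq_intros simp: algebra_simps)
  have "frechet_derivative (\<lambda>x. \<alpha> * exp (a \<bullet> x) + b \<bullet> x + c) (at x) v =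
      \<alpha> * (a \<bullet> v) * exp (a \<bullet> x) + b \<bullet> v" for x v
    using frechet_derivative_at[OF D] by metis
  moreover have "Ck_on k S (\<lambda>x. \<alpha> * (a \<bullet> v) * exp (a \<bullet> x) + b \<bullet> v)" for v
    using Suc[of "\<alpha> * (a \<bullet> v)" 0 "b \<bullet> v"] by simp
  moreover have "(\<lambda>x. \<alpha> * exp (a \<bullet> x) + b \<bullet> x + c) differentiable (at x)" for x
    using D unfolding differentiable_def by blast
  ultimately show ?case by simp
qed

lemma convex_on_exp_affine:
  fixes a b :: "'a::euclidean_space"
  assumes "convex S" "\<alpha> \<ge> 0"
  shows "convex_on S (\<lambda>x. \<alpha> * exp (a \<bullet> x) + b \<bullet> x + c)"
proof (rule convex_onI)
  fix t x y assume t: "0 < t" "t < (1::real)" and "x \<in> S" "y \<in> S"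
  have "convex_on UNIV (exp :: real \<Rightarrow> real)"
    using exp_convex by simp
  from convex_onD[OF this, of t "a \<bullet> x" "a \<bullet> y"] t
  have "exp (a \<bullet> ((1 - t) *\<^sub>R x + t *\<^sub>R y)) \<le> (1 - t) * exp (a \<bullet> x) + t * exp (a \<bullet> y)"
    by (simp add: inner_add_right)
  from mult_left_mono[OF this \<open>\<alpha> \<ge> 0\<close>]
  show "\<alpha> * exp (a \<bullet> ((1 - t) *\<^sub>R x + t *\<^sub>R y)) + b \<bullet> ((1 - t) *\<^sub>R x + t *\<^sub>R y) + c
     \<le> (1 - t) * (\<alpha> * exp (a \<bullet> x) + b \<bullet> x + c) + t * (\<alpha> * exp (a \<bullet> y) + b \<bullet> y + c)"
    by (simp add: inner_add_right algebra_simps)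
qed fact

text \<open>Constraints active at \<open>x\<close> are homogeneous about \<open>x\<close>, so
  dilation preserves them; each inactive one holds strictly at \<open>x\<close>, hence still for
  dilated points close to it. Finitely many constraints give a common radius. For
  \<open>e < 1\<close> this fails at the boundary of a round ball.\<close>

lemma polyhedron_dilation:
  fixes P :: "'a::euclidean_space set"
  assumes "polyhedron P" "x \<in> P" "e > 0"
  shows "\<exists>d>0. \<forall>y\<in>P. dist y x < d \<longrightarrow> x + (1 / e) *\<^sub>R (y - x) \<in> P"
proof -
  obtain F where F: "finite F" "P = \<Inter>F"
    and hs: "\<And>h. h \<in> F \<Longrightarrow> \<exists>a b. a \<noteq> 0 \<and> h = {x. a \<bullet> x \<le> b}"
    using assms(1) unfolding polyhedron_def by metis
  have "\<forall>\<^sub>F y in at x within P. x + (1 / e) *\<^sub>R (y - x) \<in> h" if "h \<in> F" for h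
  proof -
    obtain a b where h: "h = {x. a \<bullet> x \<le> b}" using hs[OF \<open>h \<in> F\<close>] by blast
    have "P \<subseteq> h" using F that by auto
    show ?thesis
    proof (cases "a \<bullet> x = b")
      case True
      have "x + (1 / e) *\<^sub>R (y - x) \<in> h" if "y \<in> P" for y
      proof -
        have "a \<bullet> y \<le> b" using \<open>P \<subseteq> h\<close> that h by auto
        hence "(1 / e) * (a \<bullet> y - a \<bullet> x) \<le> 0"
          using True \<open>e > 0\<close> by (simp add: mult_nonneg_nonpos divide_nonpos_pos)
        thus ?thesis using True h by (simp add: inner_add_right inner_diff_right)
      qed
      thus ?thesis by (auto simp: eventually_at_filter)
    next
      case False
      hence lt: "a \<bullet> x < b" using \<open>P \<subseteq> h\<close> \<open>x \<in> P\<close> h by force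
      have "((\<lambda>y. a \<bullet> (x + (1 / e) *\<^sub>R (y - x))) \<longlongrightarrow> a \<bullet> (x + (1 / e) *\<^sub>R (x - x))) (at x within P)"
        by (intro tendsto_intros)
      from order_tendstoD(2)[OF this, of b] lt
      have "\<forall>\<^sub>F y in at x within P. a \<bullet> (x + (1 / e) *\<^sub>R (y - x)) < b" by simp
      thus ?thesis by eventually_elim (simp add: h)
    qed
  qed
  hence "\<forall>\<^sub>F y in at x within P. \<forall>h\<in>F. x + (1 / e) *\<^sub>R (y - x) \<in> h"
    using F(1) by (simp add: eventually_ball_finite)
  then obtain d where "d > 0" "\<And>y. y \<in> P \<Longrightarrow> y \<noteq> x \<Longrightarrow> dist y x < d \<Longrightarrow> x + (1 / e) *\<^sub>R (y - x) \<in> P"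
    unfolding eventually_at F(2) by auto
  moreover have "x + (1 / e) *\<^sub>R (x - x) \<in> P" using assms by simp
  ultimately show ?thesis by metis
qed

lemma convex_on_legendre_dual:
  assumes "convex S" and bdd: "\<And>x \<xi>. x \<in> S \<Longrightarrow> \<xi> \<bullet> x - \<phi> \<xi> \<le> C"
  shows "convex_on S (legendre_dual UNIV \<phi>)"
proof (rule convex_onI)
  fix t x y assume t: "0 < t" "t < (1::real)" and xy: "x \<in> S" "y \<in> S"
  have le: "\<xi> \<bullet> z - \<phi> \<xi> \<le> legendre_dual UNIV \<phi> z" if "z \<in> S" for z \<xi>
    unfolding legendre_dual_def
    by (rule cSUP_upper) (auto intro!: bdd_aboveI bdd[OF that])
  show "legendre_dual UNIV \<phi> ((1 - t) *\<^sub>R x + t *\<^sub>R y)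
      \<le> (1 - t) * legendre_dual UNIV \<phi> x + t * legendre_dual UNIV \<phi> y"
    unfolding legendre_dual_def[of _ _ "(1 - t) *\<^sub>R x + t *\<^sub>R y"]
  proof (rule cSUP_least)
    fix \<xi>
    have "\<xi> \<bullet> ((1 - t) *\<^sub>R x + t *\<^sub>R y) - \<phi> \<xi> = (1 - t) * (\<xi> \<bullet> x - \<phi> \<xi>) + t * (\<xi> \<bullet> y - \<phi> \<xi>)"
      by (simp add: inner_add_right algebra_simps)
    also have "\<dots> \<le> (1 - t) * legendre_dual UNIV \<phi> x + t * legendre_dual UNIV \<phi> y"
      using t le xy by (intro add_mono mult_left_mono) auto
    finally show "\<xi> \<bullet> ((1 - t) *\<^sub>R x + t *\<^sub>R y) - \<phi> \<xi>
      \<le> (1 - t) * legendre_dual UNIV \<phi> x + t * legendre_dual UNIV \<phi> y" .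
  qed simp
qed fact

text \<open>Lower semicontinuity comes from being a supremum of affine functions. For upper
  semicontinuity, \<open>y\<close> close to \<open>x\<close> is written as a convex combination of
  \<open>x\<close> and its dilation \<open>z\<close>, which stays in the polyhedron and carries only
  the small weight \<open>e\<close>; there the dual is at most \<open>C\<close>.\<close>

lemma continuous_on_legendre_dual:
  fixes P :: "'a::euclidean_space set"
  assumes "polyhedron P" and bdd: "\<And>x \<xi>. x \<in> P \<Longrightarrow> \<xi> \<bullet> x - \<phi> \<xi> \<le> C"
  shows "continuous_on P (legendre_dual UNIV \<phi>)"
  unfolding continuous_on_def
proof (intro ballI order_tendstoI)
  let ?u = "legendre_dual UNIV \<phi>"
  have le: "\<xi> \<bullet> z - \<phi> \<xi> \<le> ?u z" if "z \<in> P" for z \<xi>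
    unfolding legendre_dual_def
    by (rule cSUP_upper) (auto intro!: bdd_aboveI bdd[OF that])
  have leC: "?u z \<le> C" if "z \<in> P" for z
    unfolding legendre_dual_def by (rule cSUP_least) (auto intro: bdd[OF that])
  have convex: "convex_on P ?u"
    using convex_on_legendre_dual[OF _ bdd] assms(1) polyhedron_imp_convex by blast
  fix x assume "x \<in> P"
  {
    fix m assume "m < ?u x"
    then obtain \<xi> where xi: "m < \<xi> \<bullet> x - \<phi> \<xi>"
      unfolding legendre_dual_def
      by (subst (asm) less_cSUP_iff) (auto intro!: bdd_aboveI bdd[OF \<open>x \<in> P\<close>])
    have "((\<lambda>y. \<xi> \<bullet> y - \<phi> \<xi>) \<longlongrightarrow> \<xi> \<bullet> x - \<phi> \<xi>) (at x within P)"
      by (intro tendsto_intros)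
    from order_tendstoD(1)[OF this xi]
    have "\<forall>\<^sub>F y in at x within P. m < \<xi> \<bullet> y - \<phi> \<xi>" .
    moreover have "\<forall>\<^sub>F y in at x within P. y \<in> P"
      by (simp add: eventually_at_filter)
    ultimately show "\<forall>\<^sub>F y in at x within P. m < ?u y"
      by eventually_elim (use le less_le_trans in blast)
  }
  {
    fix m assume m: "?u x < m"
    \<comment> \<open>Chosen so that \<open>e * (C - ?u x) < m - ?u x\<close>. The summand 1 keeps
      the denominator positive when \<open>C = ?u x\<close>, and the cap at 1 makes \<open>e\<close>
      a convex weight.\<close>
    define e where "e = min 1 ((m - ?u x) / (2 * (C - ?u x + 1)))"
    have pos: "C - ?u x + 1 > 0" using leC[OF \<open>x \<in> P\<close>] by simp
    have e: "0 < e" "e \<le> 1" using m pos by (auto simp: e_def)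
    have "e \<le> (m - ?u x) / (2 * (C - ?u x + 1))" by (simp add: e_def)
    hence "e * (2 * (C - ?u x + 1)) \<le> m - ?u x" using pos by (simp add: pos_le_divide_eq)
    moreover have "e * (C - ?u x) < e * (2 * (C - ?u x + 1))"
      using e pos by (intro mult_strict_left_mono) auto
    ultimately have less: "e * (C - ?u x) < m - ?u x" by linarith
    obtain d where d: "d > 0" "\<And>y. y \<in> P \<Longrightarrow> dist y x < d \<Longrightarrow> x + (1 / e) *\<^sub>R (y - x) \<in> P"
      using polyhedron_dilation[OF assms(1) \<open>x \<in> P\<close> e(1)] by blast
    have "?u y < m" if y: "y \<in> P" "dist y x < d" for y
    proof -
      define z where "z = x + (1 / e) *\<^sub>R (y - x)"
      have z: "z \<in> P" using d(2) y by (simp add: z_def)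
      have "y = (1 - e) *\<^sub>R x + e *\<^sub>R z" using e by (simp add: z_def algebra_simps)
      hence "?u y \<le> (1 - e) * ?u x + e * ?u z"
        using convex_onD[OF convex, of e x z] e z \<open>x \<in> P\<close> by simp
      also have "\<dots> \<le> (1 - e) * ?u x + e * C"
        using leC[OF z] e by simp
      finally show ?thesis using less by (simp add: algebra_simps)
    qed
    thus "\<forall>\<^sub>F y in at x within P. ?u y < m"
      unfolding eventually_at using \<open>d > 0\<close> by blast
  }
qed

section \<open>Growth of the reference potential, read off in the vertex charts\<close>

lemma edge_generator_step:
  assumes "delzant_frame P p v"
  obtains t where "t > 0" "p + t *\<^sub>R v j \<in> P"
proof -
  define E where "E = P \<inter> {p + t *\<^sub>R v j |t. t \<ge> 0}"
  have "E \<in> {e. e edge_of P \<and> p \<in> e}"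
    using assms unfolding delzant_frame_def E_def by simp
  hence "E edge_of P" "p \<in> E" by auto
  hence "aff_dim E = 1" by (simp add: edge_of_def)
  \<comment> \<open>A face of affine dimension 1 is more than a point, so the edge really extends
    from \<open>p\<close> in the direction \<open>v j\<close>.\<close>
  hence "E \<noteq> {p}" by auto
  then obtain q where "q \<in> E" "q \<noteq> p" using \<open>p \<in> E\<close> by blast
  then obtain t where "t \<ge> 0" "q = p + t *\<^sub>R v j" "q \<in> P" by (auto simp: E_def)
  moreover have "t \<noteq> 0" using calculation \<open>q \<noteq> p\<close> by auto
  ultimately show ?thesis using that[of t] by auto
qed

text \<open>The maximisers form a nonempty compact face, and an extreme point of a face is extreme
  in the whole polytope.\<close>

lemma polytope_linear_max_extreme:
  fixes P :: "'a::euclidean_space set"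
  assumes "polytope P" "P \<noteq> {}"
  obtains p where "p extreme_point_of P" "\<And>x. x \<in> P \<Longrightarrow> x \<bullet> \<xi> \<le> p \<bullet> \<xi>"
proof -
  have P: "compact P" "convex P"
    using assms polytope_imp_compact polytope_imp_convex by auto
  obtain m where m: "m \<in> P" "\<And>x. x \<in> P \<Longrightarrow> \<xi> \<bullet> x \<le> \<xi> \<bullet> m"
    using continuous_attains_sup[OF P(1) assms(2) continuous_on_inner[OF continuous_on_const continuous_on_id]]
    by blast
  define F where "F = P \<inter> {x. \<xi> \<bullet> x = \<xi> \<bullet> m}"
  have face: "F face_of P"
    unfolding F_def by (intro face_of_Int_supporting_hyperplane_le P m)
  have "m \<in> F" by (simp add: F_def m)
  then obtain p where p: "p extreme_point_of F"
    using extreme_point_exists_convex[of F] face_of_imp_compact[OF P(2,1) face]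
      face_of_imp_convex[OF face] by blast
  hence "p \<in> F" by (simp add: extreme_point_of_def)
  hence "\<And>x. x \<in> P \<Longrightarrow> x \<bullet> \<xi> \<le> p \<bullet> \<xi>"
    using m by (simp add: F_def inner_commute)
  moreover have "p extreme_point_of P"
    using extreme_point_of_face[OF face] p by simp
  ultimately show ?thesis using that by blast
qed

text \<open>For given \<xi> take a vertex \<open>p\<close> maximising
  \<open>x \<bullet> \<xi>\<close>. The edge generators at \<open>p\<close> then satisfy
  \<open>v j \<bullet> \<xi> \<le> 0\<close>, so \<xi> corresponds to chart points with all
  coordinates of modulus at most 1, and the chart function, which is
  \<open>\<phi> \<xi> - p \<bullet> \<xi>\<close> there, is bounded on a compact set. The maximum
  over the finitely many vertices is uniform.\<close>

lemma kaehler_potential_growth: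
  fixes P :: "(real ^ 'n) set"
  assumes "toric_fano_polytope P" "anticanonical_kaehler_potential P \<phi>"
  shows "\<exists>C. \<forall>x\<in>P. \<forall>\<xi>. \<xi> \<bullet> x - \<phi> \<xi> \<le> C"
proof -
  have P: "polytope P" "0 \<in> interior P" and delz: "delzant P"
    using assms(1) by (auto simp: toric_fano_polytope_def reflexive_def integral_polytope_def)
  define V where "V = {p. p extreme_point_of P}"
  have "\<exists>C. \<forall>\<xi>. (\<forall>x\<in>P. x \<bullet> \<xi> \<le> p \<bullet> \<xi>) \<longrightarrow> p \<bullet> \<xi> - \<phi> \<xi> \<le> C" if p: "p \<in> V" for p
  proof -
    obtain v where fr: "delzant_frame P p v"
      using delz p unfolding delzant_def V_def by blast
    obtain f :: "complex ^ 'n \<Rightarrow> real" where f: "smooth_on UNIV f"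
      "\<And>w \<xi>. (\<forall>j. (norm (w $ j))\<^sup>2 = exp (v j \<bullet> \<xi>)) \<Longrightarrow> f w = \<phi> \<xi> - p \<bullet> \<xi>"
      using assms(2) fr unfolding anticanonical_kaehler_potential_def by blast
    \<comment> \<open>This ball contains the closed unit polydisc.\<close>
    define K where "K = cball (0::complex ^ 'n) (sqrt (real CARD('n)))"
    have "continuous_on UNIV f"
      using f(1) by (auto simp: smooth_on_def dest: spec[of _ "0::nat"])
    hence "bounded (f ` K)"
      by (intro compact_imp_bounded compact_continuous_image) (auto simp: K_def intro: continuous_on_subset)
    then obtain C where C: "\<And>w. w \<in> K \<Longrightarrow> \<bar>f w\<bar> \<le> C"
      by (auto simp: bounded_iff)
    have "p \<bullet> \<xi> - \<phi> \<xi> \<le> C" if max: "\<forall>x\<in>P. x \<bullet> \<xi> \<le> p \<bullet> \<xi>" for \<xi>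
    proof -
      \<comment> \<open>Any point of the torus orbit over \<xi> would serve; this is the one with
        positive real coordinates.\<close>
      define w :: "complex ^ 'n" where "w = (\<chi> j. of_real (exp (v j \<bullet> \<xi> / 2)))"
      have n: "(norm (w $ j))\<^sup>2 = exp (v j \<bullet> \<xi>)" for j
        by (simp add: w_def flip: exp_double)
      have "v j \<bullet> \<xi> \<le> 0" for j
      proof -
        obtain t where t: "t > 0" "p + t *\<^sub>R v j \<in> P" by (rule edge_generator_step[OF fr])
        with max have "(p + t *\<^sub>R v j) \<bullet> \<xi> \<le> p \<bullet> \<xi>" by blast
        hence "t * (v j \<bullet> \<xi>) \<le> 0" by (simp add: inner_add_left)
        thus ?thesis using t by (simp add: mult_le_0_iff)
      qed
      hence "(\<Sum>j\<in>UNIV. (norm (w $ j))\<^sup>2) \<le> (\<Sum>j\<in>(UNIV::'n set). 1)"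
        unfolding n by (intro sum_mono) simp
      hence "w \<in> K" by (simp add: K_def norm_vec_def L2_set_def)
      from C[OF this] f(2)[of w \<xi>] n show ?thesis by auto
    qed
    thus ?thesis by blast
  qed
  then obtain C where C: "\<And>p \<xi>. p \<in> V \<Longrightarrow> (\<forall>x\<in>P. x \<bullet> \<xi> \<le> p \<bullet> \<xi>) \<Longrightarrow> p \<bullet> \<xi> - \<phi> \<xi> \<le> C p"
    by metis
  have fin: "finite V"
    unfolding V_def using P(1) by (intro finite_polyhedron_extreme_points polytope_imp_polyhedron)
  have "\<xi> \<bullet> x - \<phi> \<xi> \<le> Max (C ` V)" if "x \<in> P" for x \<xi>
  proof -
    obtain p where p: "p extreme_point_of P" "\<And>x. x \<in> P \<Longrightarrow> x \<bullet> \<xi> \<le> p \<bullet> \<xi>"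
      by (rule polytope_linear_max_extreme[OF P(1), of \<xi>]) (use \<open>x \<in> P\<close> in auto)
    have "\<xi> \<bullet> x - \<phi> \<xi> \<le> p \<bullet> \<xi> - \<phi> \<xi>" using p(2)[OF that] by (simp add: inner_commute)
    also have "\<dots> \<le> C p" using C p by (simp add: V_def)
    also have "\<dots> \<le> Max (C ` V)" using fin p by (intro Max_ge) (auto simp: V_def)
    finally show ?thesis .
  qed
  thus ?thesis by blast
qed

lemma coercive_attains_inf:
  fixes \<phi> :: "'a::euclidean_space \<Rightarrow> real"
  assumes "continuous_on UNIV \<phi>" "r > 0" and growth: "\<And>\<xi>. \<phi> \<xi> \<ge> r * norm \<xi> - C"
  obtains \<xi>\<^sub>0 where "\<And>\<xi>. \<phi> \<xi>\<^sub>0 \<le> \<phi> \<xi>"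
proof -
  \<comment> \<open>Outside this ball the growth bound already exceeds \<open>\<phi> 0\<close>; the
    \<open>max\<close> keeps 0 inside it.\<close>
  define R where "R = max 0 ((\<phi> 0 + C) / r)"
  obtain \<xi>\<^sub>0 where min: "\<xi>\<^sub>0 \<in> cball 0 R" "\<And>\<xi>. \<xi> \<in> cball 0 R \<Longrightarrow> \<phi> \<xi>\<^sub>0 \<le> \<phi> \<xi>"
    using continuous_attains_inf[of "cball 0 R" \<phi>] assms(1)
    by (force simp: R_def intro: continuous_on_subset)
  have "\<phi> \<xi>\<^sub>0 \<le> \<phi> \<xi>" for \<xi>
  proof (cases "norm \<xi> \<le> R")
    case True
    thus ?thesis using min by simp
  next
    case False
    hence "(\<phi> 0 + C) / r < norm \<xi>" by (simp add: R_def)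
    hence "\<phi> 0 + C < r * norm \<xi>" using \<open>r > 0\<close> by (simp add: pos_divide_less_eq mult.commute)
    moreover have "\<phi> \<xi>\<^sub>0 \<le> \<phi> 0" using min by (simp add: R_def)
    ultimately show ?thesis using growth[of \<xi>] by linarith
  qed
  thus ?thesis using that by blast
qed

text \<open>A minimiser \<open>\<xi>\<^sub>0\<close> of \<phi> attains the supremum defining the
  dual at 0, so \<open>\<xi>\<^sub>0 \<bullet> x - \<phi> \<xi>\<^sub>0\<close> supports the dual
  from below with contact at 0; subtracting it normalises. As \<open>exp s - 1 - s\<close> is
  convex, nonnegative and zero at 0, one base point serves all \<open>t\<close> and
  \<open>a\<close>, and the difference from the dual stays smooth on the whole space.\<close>

lemma normalized_class_exp_perturbation:
  fixes P :: "(real ^ 'n) set"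
  assumes "toric_fano_polytope P" "anticanonical_kaehler_potential P \<phi>"
  obtains u where "\<And>t a. t \<ge> 0 \<Longrightarrow>
    (\<lambda>x. u x + t * (exp (a \<bullet> x) - 1 - a \<bullet> x)) \<in> normalized_class P \<phi>"
proof -
  have P: "polytope P" "0 \<in> interior P"
    using assms(1) by (auto simp: toric_fano_polytope_def reflexive_def integral_polytope_def)
  hence convP: "convex P" by (simp add: polytope_imp_convex)
  obtain C where C: "\<And>x \<xi>. x \<in> P \<Longrightarrow> \<xi> \<bullet> x - \<phi> \<xi> \<le> C"
    using kaehler_potential_growth[OF assms] by blast
  obtain r where r: "r > 0" "cball 0 r \<subseteq> P"
    using P(2) unfolding mem_interior_cball by blast
  have "\<phi> \<xi> \<ge> r * norm \<xi> - C" for \<xi>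
  proof -
    \<comment> \<open>The point of norm \<open>r\<close> in the direction of \<xi>; for
      \<open>\<xi> = 0\<close> division by zero makes it 0, which is harmless.\<close>
    have "(r / norm \<xi>) *\<^sub>R \<xi> \<in> P" using r by (intro subsetD[OF r(2)]) simp
    from C[OF this, of \<xi>] show ?thesis
      by (cases "\<xi> = 0") (auto simp: dot_square_norm power2_eq_square)
  qed
  moreover have "continuous_on UNIV \<phi>"
    using assms(2) by (auto simp: anticanonical_kaehler_potential_def smooth_on_def dest: spec[of _ "0::nat"])
  ultimately obtain \<xi>\<^sub>0 where min: "\<And>\<xi>. \<phi> \<xi>\<^sub>0 \<le> \<phi> \<xi>"
    using coercive_attains_inf r(1) by blast
  define u\<^sub>0 where "u\<^sub>0 = legendre_dual UNIV \<phi>"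
  have cont: "continuous_on P u\<^sub>0"
    unfolding u\<^sub>0_def using P C by (intro continuous_on_legendre_dual polytope_imp_polyhedron)
  have conv: "convex_on (interior P) u\<^sub>0"
    unfolding u\<^sub>0_def using convP C interior_subset[of P]
    by (intro convex_on_legendre_dual[of _ _ C]) (auto simp: convex_interior)
  have lower: "u\<^sub>0 x \<ge> \<xi>\<^sub>0 \<bullet> x - \<phi> \<xi>\<^sub>0" if "x \<in> P" for x
    unfolding u\<^sub>0_def legendre_dual_def
    by (rule cSUP_upper) (auto intro!: bdd_aboveI C[OF that])
  have "u\<^sub>0 0 \<le> - \<phi> \<xi>\<^sub>0"
    unfolding u\<^sub>0_def legendre_dual_def by (rule cSUP_least) (auto simp: min)
  hence u00: "u\<^sub>0 0 = - \<phi> \<xi>\<^sub>0"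
    using lower[of 0] P(2) interior_subset[of P] by force
  define u where "u = (\<lambda>x. u\<^sub>0 x - \<xi>\<^sub>0 \<bullet> x + \<phi> \<xi>\<^sub>0)"
  have "(\<lambda>x. u x + t * (exp (a \<bullet> x) - 1 - a \<bullet> x)) \<in> normalized_class P \<phi>" if "t \<ge> 0" for t a
  proof -
    define g where "g = (\<lambda>x. t * exp (a \<bullet> x) + (- \<xi>\<^sub>0 - t *\<^sub>R a) \<bullet> x + (\<phi> \<xi>\<^sub>0 - t))"
    have eq: "(\<lambda>x. u x + t * (exp (a \<bullet> x) - 1 - a \<bullet> x)) = (\<lambda>x. u\<^sub>0 x + g x)"
      by (simp add: u_def g_def algebra_simps)
    have "smooth_on UNIV g"
      unfolding smooth_on_def g_def by (intro allI Ck_on_exp_affine)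
    moreover have "convex_on (interior P) g"
      unfolding g_def by (intro convex_on_exp_affine convex_interior convP that)
    hence "convex_on (interior P) (\<lambda>x. u\<^sub>0 x + g x)"
      by (intro convex_on_add conv)
    moreover have "continuous_on P (\<lambda>x. u\<^sub>0 x + g x)"
      unfolding g_def using cont by (intro continuous_intros)
    ultimately have "(\<lambda>x. u\<^sub>0 x + g x) \<in> potential_class P \<phi>"
      unfolding potential_class_def u\<^sub>0_def by (auto intro!: exI[of _ UNIV] exI[of _ g])
    moreover have "u\<^sub>0 0 + g 0 = 0" by (simp add: u00 g_def)
    moreover have "u\<^sub>0 x + g x \<ge> 0" if "x \<in> P" for x
    proof -
      have "exp (a \<bullet> x) - 1 - a \<bullet> x \<ge> 0" using exp_ge_add_one_self[of "a \<bullet> x"] by linarith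
      hence "t * (exp (a \<bullet> x) - 1 - a \<bullet> x) \<ge> 0" using \<open>t \<ge> 0\<close> by simp
      thus ?thesis using lower[OF that] by (simp add: g_def algebra_simps)
    qed
    ultimately show ?thesis unfolding eq normalized_class_def by simp
  qed
  thus ?thesis using that by blast
qed

section \<open>The extremal affine function\<close>

lemma set_integral_ge_const_ball:
  fixes f :: "'a::euclidean_space \<Rightarrow> real"
  assumes "set_integrable lborel S f" "ball c r \<subseteq> S"
    and "\<And>x. x \<in> S \<Longrightarrow> f x \<ge> 0" "\<And>x. x \<in> ball c r \<Longrightarrow> f x \<ge> K"
  shows "K * measure lborel (ball c r) \<le> (LINT x:S|lborel. f x)"
proof -
  have fin: "emeasure lborel (ball c r) < \<infinity>"
    by (rule emeasure_bounded_finite) simp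
  have "(LINT x:ball c r|lborel. K) \<le> (LINT x:S|lborel. f x)"
    unfolding set_lebesgue_integral_def
  proof (rule integral_mono)
    show "integrable lborel (\<lambda>x. indicator (ball c r) x *\<^sub>R K)"
      using fin by (intro integrable_scaleR_left) (simp add: integrable_indicator_iff)
    show "integrable lborel (\<lambda>x. indicator S x *\<^sub>R f x)"
      using assms(1) by (simp add: set_integrable_def)
    show "indicator (ball c r) x *\<^sub>R K \<le> indicator S x *\<^sub>R f x" for x
      using assms(2-4) by (auto simp: indicator_def)
  qed
  moreover have "(LINT x:ball c r|lborel. K) = measure lborel (ball c r) *\<^sub>R K"
    using fin by (intro set_integral_const) auto
  ultimately show ?thesis by (simp add: mult.commute)
qed

text \<open>Split by the integer part \<open>k\<close> of the norm: the integrand is at most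
  \<open>exp (- c * k)\<close> on that shell, which lies in a ball whose volume is polynomial in
  \<open>k\<close>. The resulting series converges.\<close>

lemma integrable_exp_neg_norm:
  assumes "c > 0"
  shows "integrable lborel (\<lambda>x::'a::euclidean_space. exp (- c * norm x))"
proof (rule integrableI_bounded)
  let ?n = "DIM('a)"
  let ?B = "\<lambda>k::nat. ball (0::'a) (real k + 1)"
  let ?b = "measure lborel (ball (0::'a) 1)"
  let ?a = "\<lambda>k::nat. exp (- c * real k) * ((real k + 1) ^ ?n * ?b)"
  show "(\<lambda>x::'a. exp (- c * norm x)) \<in> borel_measurable lborel" by measurable
  have em: "emeasure lborel (?B k) = ennreal ((real k + 1) ^ ?n * ?b)" for k
    using content_ball_conv_unit_ball[of "real k + 1" "0::'a"]
      emeasure_eq_ennreal_measure[of lborel "?B k"] emeasure_bounded_finite[of "?B k"]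
    by (simp add: less_top)
  have "(\<integral>\<^sup>+ x. ennreal (norm (exp (- c * norm (x::'a)))) \<partial>lborel)
      \<le> (\<integral>\<^sup>+ x. (\<Sum>k. ennreal (exp (- c * real k)) * indicator (?B k) x) \<partial>lborel)"
  proof (rule nn_integral_mono)
    fix x :: 'a
    define k where "k = nat \<lfloor>norm x\<rfloor>"
    have k: "real k \<le> norm x" "norm x < real k + 1" by (simp_all add: k_def)
    have "ennreal (norm (exp (- c * norm x))) \<le> ennreal (exp (- c * real k)) * indicator (?B k) x"
      using k \<open>c > 0\<close> by (auto intro!: ennreal_leI)
    also have "\<dots> = (\<Sum>j\<in>{k}. ennreal (exp (- c * real j)) * indicator (?B j) x)"
      by (simp del: sum_mult_indicator)
    also have "\<dots> \<le> (\<Sum>k. ennreal (exp (- c * real k)) * indicator (?B k) x)"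
      by (rule sum_le_suminf) auto
    finally show "ennreal (norm (exp (- c * norm x)))
      \<le> (\<Sum>k. ennreal (exp (- c * real k)) * indicator (?B k) x)" .
  qed
  also have "\<dots> = (\<Sum>k. ennreal (exp (- c * real k)) * emeasure lborel (?B k))"
  proof (subst nn_integral_suminf)
    have [measurable]: "?B k \<in> sets lborel" for k by simp
    show "(\<lambda>x. ennreal (exp (- c * real k)) * indicator (?B k) x) \<in> borel_measurable lborel" for k
      by measurable
  qed (simp add: nn_integral_cmult_indicator)
  also have "\<dots> = (\<Sum>k. ennreal (?a k))"
    unfolding em by (subst ennreal_mult') auto
  also have "\<dots> < \<infinity>"
  proof -
    \<comment> \<open>Half of the exponential decay absorbs the polynomial factor and leaves a
      geometric series.\<close>
    have "(\<lambda>k. exp (- c * real k) * (real k + 1) ^ ?n) \<in> O(\<lambda>k. exp (- (c / 2) * real k))"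
      using \<open>c > 0\<close> by real_asymp
    moreover have "summable (\<lambda>k. norm (exp (- (c / 2) * real k)))"
    proof -
      have "(\<lambda>k. norm (exp (- (c / 2) * real k))) = (\<lambda>k. exp (- (c / 2)) ^ k)"
        by (auto simp flip: exp_of_nat2_mult)
      thus ?thesis using \<open>c > 0\<close> by (auto intro!: summable_geometric)
    qed
    ultimately have "summable (\<lambda>k. exp (- c * real k) * (real k + 1) ^ ?n)"
      by (rule summable_comparison_test_bigo[rotated])
    from summable_mult2[OF this, of ?b] have "summable ?a" by (simp add: mult.assoc)
    thus ?thesis by (simp add: suminf_ennreal2 less_top)
  qed
  finally show "(\<integral>\<^sup>+ x. ennreal (norm (exp (- c * norm (x::'a)))) \<partial>lborel) < \<infinity>" .
qed

lemma continuous_on_affine_function: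
  "affine_function f \<Longrightarrow> continuous_on S f"
  unfolding affine_function_def by (auto intro!: continuous_intros cong: continuous_on_cong)

section \<open>Affine functions and their moments on a convex body\<close>

locale convex_body =
  fixes P :: "(real ^ 'n) set"
  assumes compact: "compact P" and convex: "convex P" and zero_interior: "0 \<in> interior P"
begin

lemma set_integrable_interior:
  fixes f :: "real ^ 'n \<Rightarrow> 'b::{banach, second_countable_topology}"
  assumes "continuous_on P f"
  shows "set_integrable lborel (interior P) f"
proof (rule set_integrable_subset)
  show "set_integrable lborel P f"
    unfolding set_integrable_def using compact assms by (rule borel_integrable_compact)
qed (auto simp: interior_subset)

lemma measure_interior_pos: "measure lborel (interior P) > 0"
proof -
  obtain r where r: "r > 0" "ball 0 r \<subseteq> interior P"
    using zero_interior open_contains_ball by blast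
  have "0 < 1 * measure lborel (ball (0::real ^ 'n) r)"
    using content_ball_pos[OF r(1)] by simp
  also have "\<dots> \<le> (LINT x:interior P|lborel. 1)"
    using r by (intro set_integral_ge_const_ball set_integrable_interior) auto
  also have "\<dots> = measure lborel (interior P)"
  proof -
    have "emeasure lborel (interior P) < \<infinity>"
      using compact by (intro emeasure_bounded_finite) (auto intro: bounded_interior compact_imp_bounded)
    thus ?thesis by (subst set_integral_const) auto
  qed
  finally show ?thesis .
qed

text \<open>Definiteness of the L2 pairing: if the continuous square were positive at an interior
  point, it would exceed a positive constant on a ball and have positive integral. Vanishing near 0
  then kills the constant term and, tested in the direction \<open>a\<close>, the gradient.\<close>

lemma affine_function_eq_0:
  assumes "affine_function m" and zero: "(LINT x:interior P|lborel. m x * m x) = 0"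
  shows "m x = 0"
proof -
  obtain a b where m: "\<And>x. m x = a \<bullet> x + b"
    using assms(1) unfolding affine_function_def by blast
  have cont: "continuous_on S m" for S
    using assms(1) by (rule continuous_on_affine_function)
  have D0: "m y = 0" if y: "y \<in> interior P" for y
  proof (rule ccontr)
    assume "m y \<noteq> 0"
    define K where "K = m y * m y / 2"
    have "m y * m y > 0" using \<open>m y \<noteq> 0\<close> by (metis not_real_square_gt_zero)
    hence K: "K > 0" "K < m y * m y" by (auto simp: K_def)
    have "open (interior P \<inter> {z. K < m z * m z})"
      by (intro open_Int open_interior open_Collect_less continuous_intros cont)
    then obtain s where s: "s > 0" "ball y s \<subseteq> interior P \<inter> {z. K < m z * m z}"
      using y K(2) unfolding open_contains_ball by blast
    have "K * measure lborel (ball y s) \<le> (LINT x:interior P|lborel. m x * m x)"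
      using s by (intro set_integral_ge_const_ball set_integrable_interior continuous_intros cont)
        (auto intro: less_imp_le)
    thus False using zero mult_pos_pos[OF K(1) content_ball_pos[OF s(1), of y]] by simp
  qed
  have b: "b = 0" using D0[OF zero_interior] by (simp add: m)
  obtain r where r: "r > 0" "cball 0 r \<subseteq> interior P"
    using zero_interior open_contains_cball by blast
  have "a = 0"
  proof (rule ccontr)
    assume "a \<noteq> 0"
    have "(r / norm a) *\<^sub>R a \<in> interior P" using r by (intro subsetD[OF r(2)]) simp
    from D0[OF this] show False using r \<open>a \<noteq> 0\<close> by (simp add: m b)
  qed
  thus ?thesis by (simp add: m b)
qed

text \<open>Pairing with affine functions sees only the first moment and the total integral of
  \<open>f\<close>, so the conditions defining the extremal function for all \<open>u\<close> reduce
  to one finite-dimensional linear equation.\<close>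

lemma integral_affine_mult:
  assumes "continuous_on P f"
  shows "(LINT x:interior P|lborel. (a \<bullet> x + d) * f x) =
    a \<bullet> (LINT x:interior P|lborel. f x *\<^sub>R x) + d * (LINT x:interior P|lborel. f x)"
proof -
  have i: "set_integrable lborel (interior P) (\<lambda>x. f x *\<^sub>R x)"
    by (intro set_integrable_interior continuous_intros assms)
  have "(LINT x:interior P|lborel. (a \<bullet> x + d) * f x) =
      (LINT x:interior P|lborel. a \<bullet> (f x *\<^sub>R x) + d * f x)"
    by (simp add: algebra_simps)
  also have "\<dots> = (LINT x:interior P|lborel. a \<bullet> (f x *\<^sub>R x)) + (LINT x:interior P|lborel. d * f x)"
    by (intro set_integral_add set_integrable_interior continuous_intros assms)
  also have "(LINT x:interior P|lborel. a \<bullet> (f x *\<^sub>R x)) = a \<bullet> (LINT x:interior P|lborel. f x *\<^sub>R x)"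
    using i unfolding set_lebesgue_integral_def set_integrable_def
    by (subst integral_inner_right[symmetric]) (auto simp: mult.assoc)
  finally show ?thesis by simp
qed

text \<open>
  The moment map \<open>(b, c) \<mapsto> (\<integral> x l, \<integral> l)\<close> of \<open>l = b \<bullet> x + c\<close> is injective because its matrix is the
  Gram matrix of the affine functions; hence it is surjective.
\<close>

lemma ex_extremal_affine:
  "\<exists>l. affine_function l \<and>
    (\<forall>u. affine_function u \<longrightarrow> - u 0 + (LINT x:interior P|lborel. u x * l x) = 0)"
proof -
  define T :: "(real ^ 'n) \<times> real \<Rightarrow> (real ^ 'n) \<times> real" where
    "T = (\<lambda>p. (LINT x:interior P|lborel. (fst p \<bullet> x + snd p) *\<^sub>R x,
               LINT x:interior P|lborel. fst p \<bullet> x + snd p))"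
  have i1: "set_integrable lborel (interior P) (\<lambda>x. (b \<bullet> x + c) *\<^sub>R x)" for b c
    by (intro set_integrable_interior continuous_intros)
  have i2: "set_integrable lborel (interior P) (\<lambda>x. b \<bullet> x + c)" for b c
    by (intro set_integrable_interior continuous_intros)
  have "linear T"
  proof (rule linearI)
    fix p q
    have "(LINT x:interior P|lborel. (fst (p + q) \<bullet> x + snd (p + q)) *\<^sub>R x) =
      (LINT x:interior P|lborel. (fst p \<bullet> x + snd p) *\<^sub>R x + (fst q \<bullet> x + snd q) *\<^sub>R x)"
      by (simp add: inner_add_left algebra_simps)
    moreover have "(LINT x:interior P|lborel. fst (p + q) \<bullet> x + snd (p + q)) =
      (LINT x:interior P|lborel. (fst p \<bullet> x + snd p) + (fst q \<bullet> x + snd q))"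
      by (simp add: inner_add_left algebra_simps)
    ultimately show "T (p + q) = T p + T q"
      by (simp add: T_def set_integral_add(2)[OF i1 i1] set_integral_add(2)[OF i2 i2])
  next
    fix r p
    have "(LINT x:interior P|lborel. (fst (r *\<^sub>R p) \<bullet> x + snd (r *\<^sub>R p)) *\<^sub>R x) =
      (LINT x:interior P|lborel. r *\<^sub>R ((fst p \<bullet> x + snd p) *\<^sub>R x))"
      by (simp add: algebra_simps)
    moreover have "(LINT x:interior P|lborel. fst (r *\<^sub>R p) \<bullet> x + snd (r *\<^sub>R p)) =
      (LINT x:interior P|lborel. r * (fst p \<bullet> x + snd p))"
      by (simp add: algebra_simps)
    ultimately show "T (r *\<^sub>R p) = r *\<^sub>R T p"
      unfolding T_def set_integral_scaleR_right set_integral_mult_right by simp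
  qed
  moreover have "inj T"
    unfolding linear_injective_0[OF \<open>linear T\<close>]
  proof (intro allI impI)
    fix p assume T0: "T p = 0"
    obtain b c where p: "p = (b, c)" by force
    have "(LINT x:interior P|lborel. (b \<bullet> x + c) * (b \<bullet> x + c)) = 0"
      using T0 by (subst integral_affine_mult) (auto simp: T_def p zero_prod_def intro!: continuous_intros)
    moreover have "affine_function (\<lambda>x. b \<bullet> x + c)" by (auto simp: affine_function_def)
    ultimately have eq0: "b \<bullet> x + c = 0" for x
      by (intro affine_function_eq_0[of "\<lambda>x. b \<bullet> x + c" x])
    have "c = 0" using eq0[of 0] by simp
    moreover have "b = 0" using eq0[of b] \<open>c = 0\<close> by simp
    ultimately show "p = 0" by (simp add: p zero_prod_def)
  qed
  ultimately have "surj T" by (rule linear_injective_imp_surjective) (rule refl)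
  \<comment> \<open>First moment 0 and total integral 1 make the pairing with
    \<open>a \<bullet> x + d\<close> equal to \<open>d\<close>, the value at 0.\<close>
  then obtain p where "T p = (0, 1)" by (metis surjD)
  then obtain b c where bc: "T (b, c) = (0, 1)" by (cases p) auto
  define l where "l = (\<lambda>x. b \<bullet> x + c)"
  have "- u 0 + (LINT x:interior P|lborel. u x * l x) = 0" if u: "affine_function u" for u
  proof -
    obtain a d where "\<And>x. u x = a \<bullet> x + d" using u unfolding affine_function_def by blast
    moreover have "(LINT x:interior P|lborel. (a \<bullet> x + d) * l x) = d"
      using bc by (subst integral_affine_mult) (auto simp: T_def l_def intro!: continuous_intros)
    ultimately show ?thesis by simp
  qed
  moreover have "affine_function l" by (auto simp: l_def affine_function_def)
  ultimately show ?thesis by blast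
qed

lemma extremal_affine:
  "affine_function (extremal_affine P)"
  "affine_function u \<Longrightarrow> (LINT x:interior P|lborel. u x * extremal_affine P x) = u 0"
proof -
  let ?ext = "\<lambda>l. affine_function l \<and>
    (\<forall>u. affine_function u \<longrightarrow> - u 0 + (LINT x:interior P|lborel. u x * l x) = 0)"
  have "\<exists>!l. ?ext l"
  proof (rule ex_ex1I[OF ex_extremal_affine])
    fix l m assume l: "?ext l" and m: "?ext m"
    \<comment> \<open>The difference of two solutions is itself an admissible test function: both
      pairings with it equal \<open>k 0\<close>, so the integral of its square is 0.\<close>
    define k where "k = (\<lambda>x. l x - m x)"
    have k: "affine_function k"
    proof -
      obtain a b a' b' where "\<And>x. l x = a \<bullet> x + b" "\<And>x. m x = a' \<bullet> x + b'"
        using l m unfolding affine_function_def by blast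
      thus ?thesis unfolding affine_function_def k_def
        by (intro exI[of _ "a - a'"] exI[of _ "b - b'"]) (simp add: inner_diff_left)
    qed
    have "(LINT x:interior P|lborel. k x * k x) =
        (LINT x:interior P|lborel. k x * l x - k x * m x)"
      by (simp add: k_def algebra_simps)
    also have "\<dots> = (LINT x:interior P|lborel. k x * l x) - (LINT x:interior P|lborel. k x * m x)"
      using k l m
      by (intro set_integral_diff set_integrable_interior continuous_intros continuous_on_affine_function) auto
    also have "\<dots> = 0" using k l m by auto
    finally have "k x = 0" for x using affine_function_eq_0[OF k] by blast
    thus "l = m" by (auto simp: k_def fun_eq_iff)
  qed
  from theI'[OF this] have "?ext (extremal_affine P)" unfolding extremal_affine_def .
  thus "affine_function (extremal_affine P)"
    "affine_function u \<Longrightarrow> (LINT x:interior P|lborel. u x * extremal_affine P x) = u 0"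
    by force+
qed

lemma continuous_on_extremal_affine: "continuous_on S (extremal_affine P)"
  by (intro continuous_on_affine_function extremal_affine)

text \<open>Compactness makes the supremum one of a bounded set, so the inequality can be tested
  pointwise; the positive volume then cancels.\<close>

lemma alpha_invariant_le_1_iff:
  "alpha_invariant P \<le> 1 \<longleftrightarrow> (\<forall>x\<in>P. extremal_affine P x \<ge> 0)"
proof -
  let ?f = "\<lambda>x. 1 - measure lborel (interior P) * extremal_affine P x"
  have "compact (?f ` P)"
    by (intro compact_continuous_image compact continuous_intros continuous_on_extremal_affine)
  hence bdd: "bdd_above (?f ` P)" by (intro bounded_imp_bdd_above compact_imp_bounded)
  have "P \<noteq> {}" using zero_interior interior_subset by blast
  hence "alpha_invariant P \<le> 1 \<longleftrightarrow> (\<forall>x\<in>P. ?f x \<le> 1)"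
    unfolding alpha_invariant_def by (rule cSUP_le_iff[OF _ bdd])
  also have "\<dots> \<longleftrightarrow> (\<forall>x\<in>P. extremal_affine P x \<ge> 0)"
    using measure_interior_pos by (auto simp: zero_le_mult_iff)
  finally show ?thesis .
qed

text \<open>
  With \<open>l = b \<bullet> x + c\<close> and \<open>a = - N b\<close> the weight \<open>exp (a \<bullet> x)\<close> is proportional to \<open>exp (- N l)\<close>, which for
  large \<open>N\<close> concentrates where \<open>l\<close> is negative.
\<close>

lemma destabilizing_direction:
  assumes "x\<^sub>0 \<in> P" "extremal_affine P x\<^sub>0 < 0"
  shows "\<exists>a. (LINT x:interior P|lborel. (exp (a \<bullet> x) - 1 - a \<bullet> x) * extremal_affine P x) < 0"
proof -
  define l where "l = extremal_affine P"
  have cont: "continuous_on S l" for S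
    unfolding l_def by (rule continuous_on_extremal_affine)
  obtain b c where l: "\<And>x. l x = b \<bullet> x + c"
    using extremal_affine(1) unfolding l_def affine_function_def by blast
  define \<delta> where "\<delta> = - l x\<^sub>0 / 2"
  have \<delta>: "\<delta> > 0" "l x\<^sub>0 < - \<delta>" using assms by (auto simp: \<delta>_def l_def)
  have "open {x. l x < - \<delta>}"
    by (intro open_Collect_less cont continuous_intros)
  \<comment> \<open>Negativity of \<open>l\<close> may be known only at a boundary point; density of
    the interior moves it to a ball inside.\<close>
  moreover have "x\<^sub>0 \<in> closure (interior P)"
    using assms(1) convex_closure_interior[OF convex] zero_interior closure_subset[of P] by auto
  ultimately have "interior P \<inter> {x. l x < - \<delta>} \<noteq> {}"
    using \<delta>(2) unfolding closure_iff_nhds_not_empty by blast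
  moreover have "open (interior P \<inter> {x. l x < - \<delta>})"
    using \<open>open {x. l x < - \<delta>}\<close> by auto
  ultimately obtain y s where s: "s > 0" "ball y s \<subseteq> interior P \<inter> {x. l x < - \<delta>}"
    unfolding open_contains_ball by blast
  define \<beta> where "\<beta> = measure lborel (ball y s)"
  have \<beta>: "\<beta> > 0" using content_ball_pos[OF s(1)] by (simp add: \<beta>_def)
  have "bounded (l ` P)"
    by (intro compact_imp_bounded compact_continuous_image compact cont)
  then obtain M where M: "\<And>x. x \<in> P \<Longrightarrow> \<bar>l x\<bar> \<le> M" unfolding bounded_iff by auto
  have "M \<ge> 0" using M[OF assms(1)] by linarith
  define V where "V = (LINT x:interior P|lborel. (1::real))"
  \<comment> \<open>Solves \<open>N * \<delta> * \<delta> * \<beta> = \<bar>M * V\<bar> + 1\<close>,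
    so that the gain on the ball outweighs the total \<open>M * V\<close>.\<close>
  define N where "N = (\<bar>M * V\<bar> + 1) / (\<delta> * \<delta> * \<beta>)"
  have "N > 0" using \<delta> \<beta> by (simp add: N_def)
  moreover have "N * \<delta> * \<delta> * \<beta> = \<bar>M * V\<bar> + 1" using \<delta> \<beta> by (simp add: N_def)
  ultimately have N: "N > 0" "N * \<delta> * \<delta> * \<beta> > M * V" by auto
  \<comment> \<open>Adding \<open>M\<close> makes the integrand nonnegative: where
    \<open>l \<ge> 0\<close> the exponential is at most 1 and \<open>l \<le> M\<close>. On the ball,
    \<open>exp s \<ge> 1 + s\<close> gives the lower bound
    \<open>N * \<delta> * \<delta>\<close>.\<close>
  have "(N * \<delta> * \<delta>) * measure lborel (ball y s)
      \<le> (LINT x:interior P|lborel. M - exp (- N * l x) * l x)"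
  proof (rule set_integral_ge_const_ball)
    show "set_integrable lborel (interior P) (\<lambda>x. M - exp (- N * l x) * l x)"
      by (intro set_integrable_interior continuous_intros cont)
    show "ball y s \<subseteq> interior P" using s by auto
    show "0 \<le> M - exp (- N * l x) * l x" if "x \<in> interior P" for x
    proof (cases "l x \<ge> 0")
      case True
      have "exp (- N * l x) * l x \<le> 1 * l x"
        using True N by (intro mult_right_mono) auto
      thus ?thesis using M[of x] that interior_subset[of P] by force
    next
      case False
      hence "exp (- N * l x) * l x \<le> 0" by (intro mult_nonneg_nonpos) auto
      thus ?thesis using \<open>M \<ge> 0\<close> by simp
    qed
    show "N * \<delta> * \<delta> \<le> M - exp (- N * l x) * l x" if "x \<in> ball y s" for x
    proof -
      have lx: "l x < - \<delta>" using s that by auto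
      have "N * \<delta> \<le> N * (- l x)" using lx N by (intro mult_left_mono) auto
      also have "\<dots> \<le> exp (- N * l x)" using exp_ge_add_one_self[of "- N * l x"] by simp
      finally have "(N * \<delta>) * \<delta> \<le> exp (- N * l x) * (- l x)"
        using lx \<delta> N by (intro mult_mono) auto
      thus ?thesis using \<open>M \<ge> 0\<close> by simp
    qed
  qed
  also have "\<dots> = M * V - (LINT x:interior P|lborel. exp (- N * l x) * l x)"
    by (subst set_integral_diff)
      (auto simp: V_def simp flip: set_integral_mult_right
        intro!: set_integrable_interior continuous_intros cont)
  finally have neg: "(LINT x:interior P|lborel. exp (- N * l x) * l x) < 0"
    using N(2) by (simp add: \<beta>_def)
  define a where "a = - N *\<^sub>R b"
  \<comment> \<open>The affine correction \<open>1 + a \<bullet> x\<close> pairs with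
    \<open>l\<close> to its value 1 at 0, so removing it only lowers the integral.\<close>
  have "(LINT x:interior P|lborel. (exp (a \<bullet> x) - 1 - a \<bullet> x) * l x) =
      (LINT x:interior P|lborel. exp (N * c) * (exp (- N * l x) * l x) - (a \<bullet> x + 1) * l x)"
    by (simp add: a_def l algebra_simps flip: exp_add)
  also have "\<dots> = exp (N * c) * (LINT x:interior P|lborel. exp (- N * l x) * l x)
      - (LINT x:interior P|lborel. (a \<bullet> x + 1) * l x)"
    by (subst set_integral_diff) (auto intro!: set_integrable_interior continuous_intros cont)
  also have "(LINT x:interior P|lborel. (a \<bullet> x + 1) * l x) = 1"
    using extremal_affine(2)[of "\<lambda>x. a \<bullet> x + 1"] by (auto simp: l_def affine_function_def)
  also have "exp (N * c) * (LINT x:interior P|lborel. exp (- N * l x) * l x) - 1 < 0"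
    using mult_pos_neg[OF exp_gt_zero neg, of "N * c"] by simp
  finally show ?thesis unfolding l_def by blast
qed

section \<open>Ding functionals\<close>

text \<open>
  The set \<open>{u < u x}\<close> is convex, so it misses a half-space through \<open>x\<close>.
\<close>

lemma convex_value_le_integral:
  assumes u: "continuous_on P u" "convex_on (interior P) u" "\<And>y. y \<in> interior P \<Longrightarrow> u y \<ge> 0"
    and r: "r > 0" "ball 0 (2 * r) \<subseteq> interior P" "norm x < r"
  shows "u x * measure lborel (ball (0::real ^ 'n) (r / 2)) \<le> (LINT y:interior P|lborel. u y)"
proof -
  \<comment> \<open>Translated by \<open>x\<close>, so that the convex sublevel set can be separated
    from the origin.\<close>
  define S where "S = (\<lambda>y. y - x) ` {y \<in> interior P. u y < u x}"
  have "convex {y \<in> interior P. u y < u x}"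
  proof (rule convexI)
    fix y z and s t :: real
    assume *: "y \<in> {y \<in> interior P. u y < u x}" "z \<in> {y \<in> interior P. u y < u x}"
      "0 \<le> s" "0 \<le> t" "s + t = 1"
    hence "s *\<^sub>R y + t *\<^sub>R z \<in> interior P"
      using convex_interior[OF convex] by (auto simp: convex_def)
    moreover have "u (s *\<^sub>R y + t *\<^sub>R z) \<le> max (u y) (u z)"
      using * by (intro convex_lower[OF u(2)]) auto
    ultimately show "s *\<^sub>R y + t *\<^sub>R z \<in> {y \<in> interior P. u y < u x}" using * by auto
  qed
  hence "convex S"
    unfolding S_def by (rule convex_translation_subtract)
  moreover have "0 \<notin> S" by (auto simp: S_def)
  ultimately obtain a where a: "a \<noteq> 0" "\<And>z. z \<in> S \<Longrightarrow> 0 \<le> a \<bullet> z"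
    using separating_hyperplane_set_0 by blast
  \<comment> \<open>The ball of radius \<open>r / 2\<close> about \<open>c\<close> touches the
    separating hyperplane at \<open>x\<close> from the side where \<open>u \<ge> u x\<close>, and it
    stays inside \<open>ball 0 (2 * r)\<close>.\<close>
  define c where "c = x - (r / 2 / norm a) *\<^sub>R a"
  have "norm (c - x) = r / 2" using a r by (simp add: c_def)
  have sub: "ball c (r / 2) \<subseteq> interior P"
  proof
    fix y assume "y \<in> ball c (r / 2)"
    hence "norm (y - c) < r / 2" by (simp add: dist_norm norm_minus_commute)
    moreover have "norm y \<le> norm (y - c) + norm (c - x) + norm x"
      using norm_triangle_ineq[of "y - c" "(c - x) + x"] norm_triangle_ineq[of "c - x" x] by simp
    ultimately have "norm y < 2 * r" using \<open>norm (c - x) = r / 2\<close> r by linarith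
    thus "y \<in> interior P" using r(2) by auto
  qed
  have "u x \<le> u y" if y: "y \<in> ball c (r / 2)" for y
  proof (rule ccontr)
    assume "\<not> u x \<le> u y"
    hence "y - x \<in> S" using sub y by (auto simp: S_def)
    hence "0 \<le> a \<bullet> (y - x)" by (rule a(2))
    also have "a \<bullet> (y - x) = a \<bullet> (y - c) - r / 2 * norm a"
      using a(1) by (simp add: c_def inner_diff_right inner_add_right dot_square_norm power2_eq_square)
    also have "a \<bullet> (y - c) \<le> norm a * norm (y - c)" by (rule norm_cauchy_schwarz)
    also have "norm a * norm (y - c) < norm a * (r / 2)"
      using a(1) y by (intro mult_strict_left_mono) (auto simp: dist_norm norm_minus_commute)
    finally show False by simp
  qed
  hence "u x * measure lborel (ball c (r / 2)) \<le> (LINT y:interior P|lborel. u y)"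
    using sub u by (intro set_integral_ge_const_ball set_integrable_interior)
  thus ?thesis
    using r(1) content_ball_conv_unit_ball[of "r / 2" c]
      content_ball_conv_unit_ball[of "r / 2" "0::real ^ 'n"] by simp
qed

section \<open>The modified Ding functional on normalised functions\<close>

lemma set_integral_interior_nonneg:
  fixes f :: "real ^ 'n \<Rightarrow> real"
  assumes "\<And>x. x \<in> P \<Longrightarrow> f x \<ge> 0"
  shows "(LINT x:interior P|lborel. f x) \<ge> 0"
  unfolding set_lebesgue_integral_def
proof (rule Bochner_Integration.integral_nonneg)
  show "indicator (interior P) x *\<^sub>R f x \<ge> 0" for x
    using assms interior_subset[of P] by (cases "x \<in> interior P") auto
qed

text \<open>Boundedness of the body and \<open>u \<ge> 0\<close> keep the set under the real-valued
  supremum bounded above, so it dominates each of its terms.\<close>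

lemma legendre_dual_ge:
  assumes "\<And>x. x \<in> P \<Longrightarrow> u x \<ge> 0" "x \<in> interior P"
  shows "x \<bullet> \<xi> - u x \<le> legendre_dual (interior P) u \<xi>"
  unfolding legendre_dual_def
proof (rule cSUP_upper[OF assms(2)])
  obtain R where R: "\<And>x. x \<in> P \<Longrightarrow> norm x \<le> R"
    using compact_imp_bounded[OF compact] unfolding bounded_iff by blast
  have "x \<bullet> \<xi> - u x \<le> R * norm \<xi>" if "x \<in> interior P" for x
  proof -
    have x: "x \<in> P" using that interior_subset by blast
    have "x \<bullet> \<xi> \<le> norm x * norm \<xi>" by (rule norm_cauchy_schwarz)
    also have "\<dots> \<le> R * norm \<xi>" using R[OF x] by (intro mult_right_mono) auto
    finally show ?thesis using assms(1)[OF x] by simp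
  qed
  thus "bdd_above ((\<lambda>x. x \<bullet> \<xi> - u x) ` interior P)" by (auto intro!: bdd_aboveI)
qed

text \<open>The infimum of the dual is 0, attained at 0: testing with \<open>x = 0\<close> gives
  \<open>?\<phi> \<ge> 0\<close>, and \<open>u \<ge> 0\<close> gives
  \<open>?\<phi> 0 \<le> 0\<close>.\<close>

lemma modified_ding_normalized:
  assumes "\<And>x. x \<in> P \<Longrightarrow> u x \<ge> 0" "u 0 = 0"
  shows "modified_ding P u = - ln (LINT \<xi>|lborel. exp (- legendre_dual (interior P) u \<xi>))
    + (LINT x:interior P|lborel. u x * extremal_affine P x)"
proof -
  let ?\<phi> = "legendre_dual (interior P) u"
  have ge: "?\<phi> \<xi> \<ge> 0" for \<xi>
    using legendre_dual_ge[of u 0 \<xi>, OF assms(1) zero_interior] assms(2) by simp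
  have "?\<phi> 0 \<le> 0"
    unfolding legendre_dual_def using zero_interior interior_subset[of P] assms(1)
    by (intro cSUP_least) auto
  hence "?\<phi> 0 = 0" using ge[of 0] by linarith
  hence "(INF \<eta>. ?\<phi> \<eta>) = 0"
    using ge by (intro cInf_eq_minimum) (auto simp: image_iff intro: sym)
  thus ?thesis using assms(2) by (simp add: modified_ding_def Let_def)
qed

text \<open>
  If the integrand were not integrable, its integral would be 0, with logarithm 0; this accounts for
  \<open>max 0\<close> and \<open>min 0\<close> in the next two lemmas and makes measurability of \<open>\<phi>\<close> irrelevant.
\<close>

lemma ln_integral_exp_le:
  assumes u: "continuous_on P u" "convex_on (interior P) u" "\<And>x. x \<in> P \<Longrightarrow> u x \<ge> 0" "u 0 = 0"
    and r: "r > 0" "ball 0 (2 * r) \<subseteq> interior P"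
    and s: "0 < s" "s \<le> 1"
  shows "ln (LINT \<xi>|lborel. exp (- legendre_dual (interior P) u \<xi>))
    \<le> s * (LINT x:interior P|lborel. u x) / measure lborel (ball (0::real ^ 'n) (r / 2))
      + max 0 (ln (LINT \<xi>|lborel. exp (- (s * (r / 2)) * norm (\<xi>::real ^ 'n))))"
    (is "ln ?I \<le> ?K + max 0 (ln ?J)")
proof -
  let ?\<phi> = "legendre_dual (interior P) u"
  let ?\<beta> = "measure lborel (ball (0::real ^ 'n) (r / 2))"
  define A where "A = (LINT x:interior P|lborel. u x)"
  have \<beta>: "?\<beta> > 0" using r by (intro content_ball_pos) simp
  have u_nonneg: "u x \<ge> 0" if "x \<in> interior P" for x
    using u(3) that interior_subset by blast
  have "A \<ge> 0"
    unfolding A_def using u(3) by (rule set_integral_interior_nonneg)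
  hence "?K \<ge> 0" using s \<beta> by (simp flip: A_def)
  have \<phi>: "?\<phi> \<xi> \<ge> s * (r / 2) * norm \<xi> - ?K" for \<xi>
  proof -
    \<comment> \<open>The dual is tested at \<open>s *\<^sub>R x\<close>: convexity and
      \<open>u 0 = 0\<close> give \<open>u (s *\<^sub>R x) \<le> s * u x\<close>, so slope and error
      shrink by the same factor \<open>s\<close>.\<close>
    define x where "x = (r / 2 / norm \<xi>) *\<^sub>R \<xi>"
    have nx: "norm x < r" using r by (auto simp: x_def)
    have x: "x \<in> interior P" using nx r by (intro subsetD[OF r(2)]) simp
    have sx: "s *\<^sub>R x \<in> interior P"
      using convexD_alt[OF convex_interior[OF convex] zero_interior x, of s] s by simp
    have "u x * ?\<beta> \<le> A"
      unfolding A_def using u u_nonneg r nx by (intro convex_value_le_integral)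
    hence "u x \<le> A / ?\<beta>" using \<beta> by (simp add: pos_le_divide_eq)
    hence "s * u x \<le> s * A / ?\<beta>"
      using mult_left_mono[of "u x" "A / ?\<beta>" s] s by simp
    moreover have "u (s *\<^sub>R x) \<le> s * u x"
      using convex_onD[OF u(2), of s 0 x] zero_interior x s u(4) by simp
    moreover have "(s *\<^sub>R x) \<bullet> \<xi> - u (s *\<^sub>R x) \<le> ?\<phi> \<xi>"
      using u(3) sx by (rule legendre_dual_ge)
    moreover have "(s *\<^sub>R x) \<bullet> \<xi> = s * (r / 2) * norm \<xi>"
      by (cases "\<xi> = 0") (auto simp: x_def dot_square_norm power2_eq_square)
    ultimately show ?thesis unfolding A_def by linarith
  qed
  have int: "integrable lborel (\<lambda>\<xi>::real ^ 'n. exp (- (s * (r / 2)) * norm \<xi>))"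
    using r s by (intro integrable_exp_neg_norm) simp
  show ?thesis
  proof (cases "?I = 0")
    case True
    thus ?thesis using \<open>?K \<ge> 0\<close> by simp
  next
    case False
    hence I: "integrable lborel (\<lambda>\<xi>. exp (- ?\<phi> \<xi>))"
      using not_integrable_integral_eq by blast
    have "?I \<ge> 0" by (rule integral_nonneg_AE) auto
    hence "?I > 0" using False by linarith
    have "?I \<le> (LINT \<xi>|lborel. exp ?K * exp (- (s * (r / 2)) * norm (\<xi>::real ^ 'n)))"
    proof (rule integral_mono[OF I])
      show "exp (- ?\<phi> \<xi>) \<le> exp ?K * exp (- (s * (r / 2)) * norm \<xi>)" for \<xi>
        using \<phi>[of \<xi>] by (simp flip: exp_add)
    qed (use int in simp)
    hence le: "?I \<le> exp ?K * ?J" by simp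
    hence "exp ?K * ?J > 0" using \<open>?I > 0\<close> by linarith
    hence "?J > 0" by (simp add: zero_less_mult_iff)
    have "ln ?I \<le> ln (exp ?K * ?J)" using le \<open>?I > 0\<close> by simp
    also have "\<dots> = ?K + ln ?J" using \<open>?J > 0\<close> by (simp add: ln_mult)
    finally show ?thesis by simp
  qed
qed

lemma ln_integral_exp_ge:
  "\<exists>c. \<forall>u. (\<forall>x\<in>P. u x \<ge> 0) \<longrightarrow>
    ln (LINT \<xi>|lborel. exp (- legendre_dual (interior P) u \<xi>)) \<ge> c"
proof -
  obtain R where R: "R > 0" "\<And>x. x \<in> P \<Longrightarrow> norm x \<le> R"
    using compact_imp_bounded[OF compact] unfolding bounded_pos by blast
  \<comment> \<open>For \<open>u \<ge> 0\<close> the dual is at most \<open>R\<close> on the unit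
    ball, so \<open>J\<close> bounds the integral below independently of \<open>u\<close>.\<close>
  define J where "J = exp (- R) * measure lborel (ball (0::real ^ 'n) 1)"
  have "J > 0" using content_ball_pos[of 1 "0::real ^ 'n"] by (simp add: J_def)
  have "min 0 (ln J) \<le> ln (LINT \<xi>|lborel. exp (- legendre_dual (interior P) u \<xi>))"
    if u: "\<forall>x\<in>P. u x \<ge> 0" for u
  proof (cases "integrable lborel (\<lambda>\<xi>. exp (- legendre_dual (interior P) u \<xi>))")
    case False
    thus ?thesis by (simp add: not_integrable_integral_eq)
  next
    case True
    have le: "legendre_dual (interior P) u \<xi> \<le> R" if "\<xi> \<in> ball 0 1" for \<xi>
      unfolding legendre_dual_def
    proof (rule cSUP_least)
      fix x assume "x \<in> interior P"
      hence x: "x \<in> P" using interior_subset by blast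
      have "x \<bullet> \<xi> \<le> norm x * norm \<xi>" by (rule norm_cauchy_schwarz)
      also have "\<dots> \<le> R * 1" using R(1) R(2)[OF x] that by (intro mult_mono) auto
      finally show "x \<bullet> \<xi> - u x \<le> R" using u x by force
    qed (use zero_interior in auto)
    have "J \<le> (LINT \<xi>:UNIV|lborel. exp (- legendre_dual (interior P) u \<xi>))"
      unfolding J_def using True le
      by (intro set_integral_ge_const_ball) (auto simp: set_integrable_def)
    hence "J \<le> (LINT \<xi>|lborel. exp (- legendre_dual (interior P) u \<xi>))"
      by (simp add: set_lebesgue_integral_def)
    hence "ln J \<le> ln (LINT \<xi>|lborel. exp (- legendre_dual (interior P) u \<xi>))"
      using \<open>J > 0\<close> by simp
    thus ?thesis by simp
  qed
  thus ?thesis by blast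
qed

lemma modified_ding_bounded_below:
  assumes l: "\<And>x. x \<in> P \<Longrightarrow> extremal_affine P x \<ge> 0" and "\<epsilon> > 0"
  shows "\<exists>C>0. \<forall>u\<in>normalized_class P \<phi>.
    modified_ding P u \<ge> - \<epsilon> * (LINT x:interior P|lborel. u x) - C"
proof -
  obtain r\<^sub>0 where r\<^sub>0: "r\<^sub>0 > 0" "ball 0 r\<^sub>0 \<subseteq> interior P"
    using zero_interior open_contains_ball by blast
  define r where "r = r\<^sub>0 / 2"
  have r: "r > 0" "ball 0 (2 * r) \<subseteq> interior P" using r\<^sub>0 by (auto simp: r_def)
  define \<beta> where "\<beta> = measure lborel (ball (0::real ^ 'n) (r / 2))"
  have \<beta>: "\<beta> > 0" using r unfolding \<beta>_def by (intro content_ball_pos) simp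
  \<comment> \<open>Makes the term \<open>s * A / \<beta>\<close> of the logarithmic estimate at
    most \<open>\<epsilon> * A\<close>. Since \<open>s\<close> depends only on \<epsilon> and the
    body, so does \<open>C\<close>.\<close>
  define s where "s = min 1 (\<epsilon> * \<beta>)"
  have s: "0 < s" "s \<le> 1" "s \<le> \<epsilon> * \<beta>" using \<open>\<epsilon> > 0\<close> \<beta> by (auto simp: s_def)
  define C where "C = max 0 (ln (LINT \<xi>|lborel. exp (- (s * (r / 2)) * norm (\<xi>::real ^ 'n))))"
  have "modified_ding P u \<ge> - \<epsilon> * (LINT x:interior P|lborel. u x) - (C + 1)"
    if "u \<in> normalized_class P \<phi>" for u
  proof -
    have u: "continuous_on P u" "convex_on (interior P) u" "\<And>x. x \<in> P \<Longrightarrow> u x \<ge> 0" "u 0 = 0"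
      using that by (auto simp: normalized_class_def potential_class_def)
    define A where "A = (LINT x:interior P|lborel. u x)"
    have "A \<ge> 0" unfolding A_def using u(3) by (rule set_integral_interior_nonneg)
    have "s * A / \<beta> \<le> \<epsilon> * A"
      using mult_right_mono[OF s(3) \<open>A \<ge> 0\<close>] \<beta> by (simp add: pos_divide_le_eq mult_ac)
    moreover have "ln (LINT \<xi>|lborel. exp (- legendre_dual (interior P) u \<xi>)) \<le> s * A / \<beta> + C"
      unfolding A_def \<beta>_def C_def by (intro ln_integral_exp_le u r s)
    moreover have "(LINT x:interior P|lborel. u x * extremal_affine P x) \<ge> 0"
      using u(3) l by (intro set_integral_interior_nonneg mult_nonneg_nonneg)
    ultimately show ?thesis
      using modified_ding_normalized[of u, OF u(3,4)] by (simp flip: A_def)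
  qed
  moreover have "C + 1 > 0" by (simp add: C_def)
  ultimately show ?thesis by blast
qed

end

section \<open>Rays of potentials and the converse implications\<close>

lemma linear_bounded_below_imp_nonneg:
  fixes J K :: real
  assumes "\<And>t. t \<ge> 0 \<Longrightarrow> t * J \<ge> K"
  shows "J \<ge> 0"
proof (rule ccontr)
  assume "\<not> J \<ge> 0"
  hence "(\<bar>K\<bar> + 1) / (- J) * J \<ge> K"
    by (intro assms divide_nonneg_pos) auto
  also have "(\<bar>K\<bar> + 1) / (- J) * J = - (\<bar>K\<bar> + 1)" using \<open>\<not> J \<ge> 0\<close> by simp
  finally show False by linarith
qed

text \<open>The assumed bound follows both from stability and from coercivity, so it serves both
  converse implications. Along a ray \<open>u + t * g\<close> it becomes a lower bound on an affine
  function of \<open>t\<close>, which excludes a negative slope.\<close>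

lemma extremal_affine_nonneg_of_futaki_bound:
  fixes P :: "(real ^ 'n) set"
  assumes "toric_fano_polytope P" "anticanonical_kaehler_potential P \<phi>"
    and bound: "\<And>\<epsilon>. \<epsilon> > 0 \<Longrightarrow> \<exists>C. \<forall>u\<in>normalized_class P \<phi>.
      relative_ding_futaki P u \<ge> - \<epsilon> * (LINT x:interior P|lborel. u x) - C"
    and "x\<^sub>0 \<in> P"
  shows "extremal_affine P x\<^sub>0 \<ge> 0"
proof (rule ccontr)
  have P: "polytope P" "0 \<in> interior P"
    using assms(1) by (auto simp: toric_fano_polytope_def reflexive_def integral_polytope_def)
  interpret convex_body P
    using P by unfold_locales (auto simp: polytope_imp_compact polytope_imp_convex)
  assume "\<not> extremal_affine P x\<^sub>0 \<ge> 0"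
  then obtain a where
    a: "(LINT x:interior P|lborel. (exp (a \<bullet> x) - 1 - a \<bullet> x) * extremal_affine P x) < 0"
    using destabilizing_direction[OF \<open>x\<^sub>0 \<in> P\<close>] by auto
  define g where "g = (\<lambda>x. exp (a \<bullet> x) - 1 - a \<bullet> x)"
  define J where "J = (LINT x:interior P|lborel. g x * extremal_affine P x)"
  have neg: "J < 0" using a unfolding J_def g_def .
  obtain u where u: "\<And>t. t \<ge> 0 \<Longrightarrow> (\<lambda>x. u x + t * g x) \<in> normalized_class P \<phi>"
    using normalized_class_exp_perturbation[OF assms(1,2)] unfolding g_def by metis
  have cont: "continuous_on P u" "continuous_on P g" and "u 0 = 0" "g 0 = 0"
    using u[of 0] unfolding g_def
    by (auto simp: normalized_class_def potential_class_def intro!: continuous_intros)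
  let ?l = "extremal_affine P"
  define G where "G = (LINT x:interior P|lborel. g x)"
  \<comment> \<open>Small enough that the slope \<open>J + \<epsilon> * G\<close> is at most
    \<open>J / 2\<close>; it is fixed before \<open>t\<close> varies, and with it the constant
    \<open>C\<close>. The summand 1 covers \<open>G = 0\<close>.\<close>
  define \<epsilon> where "\<epsilon> = - J / 2 / (\<bar>G\<bar> + 1)"
  have \<epsilon>: "\<epsilon> > 0" unfolding \<epsilon>_def using neg by (intro divide_pos_pos) auto
  have "\<epsilon> * G \<le> \<epsilon> * (\<bar>G\<bar> + 1)" using \<epsilon> by (intro mult_left_mono) auto
  also have "\<dots> = - J / 2"
    unfolding \<epsilon>_def by (rule nonzero_eq_divide_eq[THEN iffD1, OF _ refl]) linarith
  finally have less: "J + \<epsilon> * G < 0" using neg by simp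
  obtain C where C: "\<And>v. v \<in> normalized_class P \<phi> \<Longrightarrow>
      relative_ding_futaki P v \<ge> - \<epsilon> * (LINT x:interior P|lborel. v x) - C"
    using bound[OF \<epsilon>] by blast
  have split: "(LINT x:interior P|lborel. (u x + t * g x) * k x) =
      (LINT x:interior P|lborel. u x * k x) + t * (LINT x:interior P|lborel. g x * k x)"
    if "continuous_on P k" for k t
  proof -
    have "(LINT x:interior P|lborel. (u x + t * g x) * k x) =
        (LINT x:interior P|lborel. u x * k x + t * (g x * k x))"
      by (simp add: algebra_simps)
    thus ?thesis
      by (simp add: set_integral_add(2) set_integrable_interior continuous_intros cont that)
  qed
  have "t * (J + \<epsilon> * G) \<ge> - (LINT x:interior P|lborel. u x * ?l x)
      - \<epsilon> * (LINT x:interior P|lborel. u x) - C" if "t \<ge> 0" for t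
  proof -
    have "relative_ding_futaki P (\<lambda>x. u x + t * g x) =
        (LINT x:interior P|lborel. u x * ?l x) + t * J"
      unfolding relative_ding_futaki_def split[OF continuous_on_extremal_affine] J_def
      using \<open>u 0 = 0\<close> \<open>g 0 = 0\<close> by simp
    moreover have "(LINT x:interior P|lborel. u x + t * g x) = (LINT x:interior P|lborel. u x) + t * G"
      using split[OF continuous_on_const[of _ 1], of t] by (simp add: G_def)
    ultimately show ?thesis using C[OF u[OF that]] by (simp add: algebra_simps)
  qed
  from linear_bounded_below_imp_nonneg[OF this] less show False by linarith
qed

theorem theorem1p3:
  fixes P :: "(real ^ 'n) set" and \<phi>\<^sub>0 :: "real ^ 'n \<Rightarrow> real"
  assumes "toric_fano_polytope P"
    and "anticanonical_kaehler_potential P \<phi>\<^sub>0"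
  shows "(alpha_invariant P \<le> 1 \<longleftrightarrow> relative_ding_stable P \<phi>\<^sub>0) \<and>
    (relative_ding_stable P \<phi>\<^sub>0 \<longleftrightarrow>
      (\<forall>\<epsilon>>0. \<exists>C\<^sub>\<epsilon>>0. \<forall>u\<in>normalized_class P \<phi>\<^sub>0.
         modified_ding P u \<ge> - \<epsilon> * (LINT x:interior P|lborel. u x) - C\<^sub>\<epsilon>))"
    (is "(?alpha \<longleftrightarrow> ?stable) \<and> (?stable \<longleftrightarrow> ?coercive)")
proof -
  have P: "polytope P" "0 \<in> interior P"
    using assms(1) by (auto simp: toric_fano_polytope_def reflexive_def integral_polytope_def)
  interpret convex_body P
    using P by unfold_locales (auto simp: polytope_imp_compact polytope_imp_convex)
  have nonneg: "u x \<ge> 0" if "u \<in> normalized_class P \<phi>\<^sub>0" "x \<in> P" for u x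
    using that by (auto simp: normalized_class_def)
  have zero: "u 0 = 0" if "u \<in> normalized_class P \<phi>\<^sub>0" for u
    using that by (simp add: normalized_class_def)
  \<comment> \<open>Applied with \<open>k\<close> the extremal affine function and with
    \<open>k = 1\<close>.\<close>
  have int_nonneg: "(LINT x:interior P|lborel. u x * k x) \<ge> 0"
    if "u \<in> normalized_class P \<phi>\<^sub>0" "\<And>x. x \<in> P \<Longrightarrow> k x \<ge> 0" for u k
    using that nonneg by (intro set_integral_interior_nonneg mult_nonneg_nonneg)
  have "?stable" if "?alpha"
    unfolding relative_ding_stable_def relative_ding_futaki_def
    using that by (auto simp: alpha_invariant_le_1_iff zero int_nonneg)
  moreover have "?coercive" if "?alpha"
    using that modified_ding_bounded_below by (auto simp: alpha_invariant_le_1_iff)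
  moreover have "?alpha" if stable: "?stable"
    unfolding alpha_invariant_le_1_iff
  proof (intro ballI extremal_affine_nonneg_of_futaki_bound[OF assms])
    fix \<epsilon> :: real assume "\<epsilon> > 0"
    \<comment> \<open>Stability gives the bound with constant 0, since the integral of
      \<open>u\<close> is nonnegative.\<close>
    have "relative_ding_futaki P u \<ge> - \<epsilon> * (LINT x:interior P|lborel. u x) - 0"
      if "u \<in> normalized_class P \<phi>\<^sub>0" for u
    proof -
      have "\<epsilon> * (LINT x:interior P|lborel. u x) \<ge> 0"
        using int_nonneg[OF that, of "\<lambda>_. 1"] \<open>\<epsilon> > 0\<close> by simp
      moreover have "relative_ding_futaki P u \<ge> 0"
        using stable that by (simp add: relative_ding_stable_def)
      ultimately show ?thesis by simp
    qed
    thus "\<exists>C. \<forall>u\<in>normalized_class P \<phi>\<^sub>0.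
        relative_ding_futaki P u \<ge> - \<epsilon> * (LINT x:interior P|lborel. u x) - C" by blast
  qed
  moreover have "?alpha" if coercive: "?coercive"
    unfolding alpha_invariant_le_1_iff
  proof (intro ballI extremal_affine_nonneg_of_futaki_bound[OF assms])
    fix \<epsilon> :: real assume "\<epsilon> > 0"
    then obtain C where C: "\<And>u. u \<in> normalized_class P \<phi>\<^sub>0 \<Longrightarrow>
        modified_ding P u \<ge> - \<epsilon> * (LINT x:interior P|lborel. u x) - C"
      using coercive by blast
    obtain c where c: "\<And>u. (\<forall>x\<in>P. u x \<ge> 0) \<Longrightarrow>
        ln (LINT \<xi>|lborel. exp (- legendre_dual (interior P) u \<xi>)) \<ge> c"
      using ln_integral_exp_ge by blast
    \<comment> \<open>The invariant is the Ding functional plus the logarithm of the integral, and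
      the latter is at least \<open>c\<close> for every normalised \<open>u\<close>.\<close>
    have "relative_ding_futaki P u \<ge> - \<epsilon> * (LINT x:interior P|lborel. u x) - (C - c)"
      if "u \<in> normalized_class P \<phi>\<^sub>0" for u
      using C[OF that] c[of u] modified_ding_normalized[of u] nonneg[OF that] zero[OF that]
      by (simp add: relative_ding_futaki_def)
    thus "\<exists>C. \<forall>u\<in>normalized_class P \<phi>\<^sub>0.
        relative_ding_futaki P u \<ge> - \<epsilon> * (LINT x:interior P|lborel. u x) - C" by blast
  qed
  ultimately show ?thesis by blast
qed

end
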